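(* Let $A$ be a unital semisimple PMV-algebra and $B$ a semisimple MV-algebra. Then the semisimple tensor product $A\otimes B$ (of the MV-algebra reduct of $A$ and $B$) is an $A$-MV-module.
   Context: MV-algebras: $(A,\oplus,{}^*,0)$ with $(A,\oplus,0)$ a commutative monoid, ${}^*$ an involution, $(x^*\oplus y)^*\oplus y=(y^*\oplus x)^*\oplus x$; $1=0^*$. Partial sum $x+y$ defined iff $x\le y^*$ (then $=x\oplus y$); linear maps preserve it; bimorphisms are linear and $\vee,\wedge$-preserving in each argument. An MV-algebra is semisimple iff it is isomorphic to a separating MV-algebra of continuous $[0,1]$-valued functions on a compact Hausdorff space. For semisimple $A,B$ the semisimple tensor product $A\otimes B$ is $(A\otimes_{MV}B)/\mathrm{Rad}(A\otimes_{MV}B)$, where $A\otimes_{MV}B$ is the MV-algebra tensor product universal for bimorphisms; equivalently (Mundici), if $A\subseteq C(X)$, $B\subseteq C(Y)$, $A\otimes B$ is the MV-subalgebra of $C(X\times Y)$ generated by the functions $(x,y)\mapsto a(x)b(y)$, $a\in A$, $b\in B$. A unital PMV-algebra is an MV-algebra with a bilinear associative product $\cdot$ having unit $1$; it is semisimple if its MV-reduct is. For a PMV-algebra $P$, a $P$-MV-module is an MV-algebra $M$ with a map $(\alpha,x)\mapsto\alpha x$, $P\times M\to M$, which is bilinear, satisfies $(\alpha\cdot\beta)x=\alpha(\beta x)$ and $1x=x$. *)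

theory Defs
  imports Main
begin

section \<open>MV-algebras\<close>

text \<open>
  The axiom \<open>plus_neg_zero\<close> belongs to the standard axiomatization and does not follow
  from the other ones (consider \<open>max\<close> and the identity on a two-element chain).
\<close>

class mv_algebra = zero +
  fixes mv_plus :: "'a \<Rightarrow> 'a \<Rightarrow> 'a"  (infixl "\<oplus>" 65)
    and mv_neg :: "'a \<Rightarrow> 'a"  ("\<sim> _" [81] 80)
  assumes plus_assoc: "(x \<oplus> y) \<oplus> z = x \<oplus> (y \<oplus> z)"
    and plus_comm: "x \<oplus> y = y \<oplus> x"
    and plus_zero: "x \<oplus> 0 = x"
    and neg_neg: "\<sim> (\<sim> x) = x"
    and plus_neg_zero: "x \<oplus> \<sim> 0 = \<sim> 0"
    and lukasiewicz: "\<sim> (\<sim> x \<oplus> y) \<oplus> y = \<sim> (\<sim> y \<oplus> x) \<oplus> x"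
begin

definition mv_one :: 'a  ("\<one>")
  where "\<one> = \<sim> 0"

definition mv_le :: "'a \<Rightarrow> 'a \<Rightarrow> bool"  (infix "\<preceq>" 50)
  where "x \<preceq> y \<longleftrightarrow> \<sim> x \<oplus> y = \<one>"

definition mv_sup :: "'a \<Rightarrow> 'a \<Rightarrow> 'a"
  where "mv_sup x y = \<sim> (\<sim> x \<oplus> y) \<oplus> y"

definition mv_inf :: "'a \<Rightarrow> 'a \<Rightarrow> 'a"
  where "mv_inf x y = \<sim> (mv_sup (\<sim> x) (\<sim> y))"

text \<open>The partial sum \<open>x + y\<close> is defined iff \<open>mv_summable x y\<close>, and then equals \<open>x \<oplus> y\<close>.\<close>

definition mv_summable :: "'a \<Rightarrow> 'a \<Rightarrow> bool"
  where "mv_summable x y \<longleftrightarrow> x \<preceq> \<sim> y"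

definition mv_diff :: "'a \<Rightarrow> 'a \<Rightarrow> 'a"
  where "mv_diff x y = \<sim> (\<sim> x \<oplus> y)"

definition mv_dist :: "'a \<Rightarrow> 'a \<Rightarrow> 'a"
  where "mv_dist x y = mv_diff x y \<oplus> mv_diff y x"

lemma plus_left_comm: "x \<oplus> (y \<oplus> z) = y \<oplus> (x \<oplus> z)"
  by (metis plus_assoc plus_comm)

lemmas plus_ac = plus_assoc plus_comm plus_left_comm

lemma neg_plus_self: "\<sim> x \<oplus> x = \<one>"
  by (metis lukasiewicz mv_one_def neg_neg plus_comm plus_neg_zero plus_zero)

lemma one_plus: "\<one> \<oplus> x = \<one>" "x \<oplus> \<one> = \<one>"
  by (metis mv_one_def plus_comm plus_neg_zero)+

lemma mv_le_iff: "x \<preceq> y \<longleftrightarrow> (\<exists>z. y = x \<oplus> z)"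
proof
  assume "x \<preceq> y"
  then have "y = \<sim> (\<sim> y \<oplus> x) \<oplus> x"
    by (metis lukasiewicz mv_le_def mv_one_def neg_neg plus_comm plus_zero)
  then show "\<exists>z. y = x \<oplus> z" by (metis plus_comm)
next
  assume "\<exists>z. y = x \<oplus> z"
  then show "x \<preceq> y" unfolding mv_le_def by (metis neg_plus_self one_plus(1) plus_assoc)
qed

lemma mv_le_refl: "x \<preceq> x"
  by (simp add: mv_le_def neg_plus_self)

lemma mv_le_trans: "x \<preceq> y \<Longrightarrow> y \<preceq> z \<Longrightarrow> x \<preceq> z"
  by (metis mv_le_iff plus_assoc)

lemma mv_plus_mono: "x \<preceq> y \<Longrightarrow> z \<oplus> x \<preceq> z \<oplus> y"
  by (metis mv_le_iff plus_assoc)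

lemma mv_diff_le_iff: "mv_diff x y \<preceq> z \<longleftrightarrow> x \<preceq> y \<oplus> z"
  by (simp add: mv_diff_def mv_le_def neg_neg plus_assoc)

lemma mv_le_plus_diff: "x \<preceq> y \<oplus> mv_diff x y"
  using mv_diff_le_iff mv_le_refl by blast

lemma mv_diff_triangle: "mv_diff x z \<preceq> mv_diff x y \<oplus> mv_diff y z"
proof -
  have "x \<preceq> mv_diff x y \<oplus> y"
    using mv_le_plus_diff plus_comm by metis
  also have "mv_diff x y \<oplus> y \<preceq> mv_diff x y \<oplus> (z \<oplus> mv_diff y z)"
    by (intro mv_plus_mono mv_le_plus_diff)
  finally (mv_le_trans) show ?thesis
    by (simp add: mv_diff_le_iff plus_left_comm)
qed

lemma mv_diff_plus_le: "mv_diff (x \<oplus> z) (y \<oplus> w) \<preceq> mv_diff x y \<oplus> mv_diff z w"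
proof -
  have "z \<oplus> x \<preceq> z \<oplus> (y \<oplus> mv_diff x y)"
    by (intro mv_plus_mono mv_le_plus_diff)
  moreover have "(y \<oplus> mv_diff x y) \<oplus> z \<preceq> (y \<oplus> mv_diff x y) \<oplus> (w \<oplus> mv_diff z w)"
    by (intro mv_plus_mono mv_le_plus_diff)
  ultimately have "x \<oplus> z \<preceq> (y \<oplus> mv_diff x y) \<oplus> (w \<oplus> mv_diff z w)"
    by (metis mv_le_trans plus_comm)
  then show ?thesis
    by (simp add: mv_diff_le_iff plus_ac)
qed

end

definition mv_hom :: "('a::mv_algebra \<Rightarrow> 'b::mv_algebra) \<Rightarrow> bool"
  where "mv_hom f \<longleftrightarrow>
    f 0 = 0 \<and> (\<forall>x y. f (x \<oplus> y) = f x \<oplus> f y) \<and> (\<forall>x. f (\<sim> x) = \<sim> (f x))"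


section \<open>Ideals, radical, semisimplicity\<close>

context mv_algebra
begin

definition mv_ideal :: "'a set \<Rightarrow> bool"
  where "mv_ideal I \<longleftrightarrow>
    0 \<in> I \<and> (\<forall>x\<in>I. \<forall>y\<in>I. x \<oplus> y \<in> I) \<and> (\<forall>x y. x \<preceq> y \<and> y \<in> I \<longrightarrow> x \<in> I)"

definition mv_maximal_ideal :: "'a set \<Rightarrow> bool"
  where "mv_maximal_ideal M \<longleftrightarrow>
    mv_ideal M \<and> M \<noteq> UNIV \<and> (\<forall>I. mv_ideal I \<and> M \<subseteq> I \<longrightarrow> I = M \<or> I = UNIV)"

definition mv_Rad :: "'a set"
  where "mv_Rad = \<Inter> {M. mv_maximal_ideal M}"

lemma mv_ideal_Rad: "mv_ideal mv_Rad"
proof -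
  have "mv_ideal (\<Inter> \<M>)" if "\<And>M. M \<in> \<M> \<Longrightarrow> mv_ideal M" for \<M>
    unfolding mv_ideal_def
  proof (intro conjI ballI allI impI InterI)
    fix M x y assume M: "M \<in> \<M>"
    note I = that[OF M, unfolded mv_ideal_def]
    show "0 \<in> M" using I by simp
    show "x \<oplus> y \<in> M" if "x \<in> \<Inter> \<M>" "y \<in> \<Inter> \<M>" using I M that by simp
    show "x \<in> M" if "x \<preceq> y \<and> y \<in> \<Inter> \<M>" using I M that by (meson InterD)
  qed
  then show ?thesis
    unfolding mv_Rad_def by (metis mem_Collect_eq mv_maximal_ideal_def)
qed

definition mv_rad_cong :: "'a \<Rightarrow> 'a \<Rightarrow> bool"
  where "mv_rad_cong x y \<longleftrightarrow> mv_dist x y \<in> mv_Rad"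

lemma mv_rad_cong_iff:
  "mv_rad_cong x y \<longleftrightarrow> mv_diff x y \<in> mv_Rad \<and> mv_diff y x \<in> mv_Rad"
proof -
  have "mv_diff x y \<preceq> mv_dist x y" "mv_diff y x \<preceq> mv_dist x y"
    unfolding mv_dist_def mv_le_iff using plus_comm by blast+
  then show ?thesis
    using mv_ideal_Rad unfolding mv_rad_cong_def mv_ideal_def mv_dist_def by blast
qed

lemma mv_rad_cong_refl: "mv_rad_cong x x"
  using mv_ideal_Rad
  by (simp add: mv_rad_cong_iff mv_diff_def neg_plus_self mv_one_def neg_neg mv_ideal_def)

lemma mv_rad_cong_sym: "mv_rad_cong x y \<Longrightarrow> mv_rad_cong y x"
  by (simp add: mv_rad_cong_iff)

lemma mv_rad_cong_trans: "mv_rad_cong x y \<Longrightarrow> mv_rad_cong y z \<Longrightarrow> mv_rad_cong x z"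
  using mv_ideal_Rad mv_diff_triangle[of x z y] mv_diff_triangle[of z x y]
  unfolding mv_rad_cong_iff mv_ideal_def by meson

lemma mv_rad_cong_plus:
  "mv_rad_cong x y \<Longrightarrow> mv_rad_cong z w \<Longrightarrow> mv_rad_cong (x \<oplus> z) (y \<oplus> w)"
  using mv_ideal_Rad mv_diff_plus_le[of x z y w] mv_diff_plus_le[of y w x z]
  unfolding mv_rad_cong_iff mv_ideal_def by meson

lemma mv_rad_cong_neg: "mv_rad_cong x y \<Longrightarrow> mv_rad_cong (\<sim> x) (\<sim> y)"
  by (simp add: mv_rad_cong_iff mv_diff_def neg_neg plus_comm)

end

definition mv_semisimple :: "'a::mv_algebra itself \<Rightarrow> bool"
  where "mv_semisimple _ \<longleftrightarrow> (mv_Rad :: 'a set) = {0}"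

text \<open>The quotient \<open>A / Rad(A)\<close>.\<close>

quotient_type (overloaded) 'a mv_mod_rad = "'a::mv_algebra" / mv_rad_cong
  by (intro equivpI reflpI sympI transpI)
    (fact mv_rad_cong_refl, fact mv_rad_cong_sym, fact mv_rad_cong_trans)

instantiation mv_mod_rad :: (mv_algebra) mv_algebra
begin

lift_definition zero_mv_mod_rad :: "'a mv_mod_rad" is 0 .

lift_definition mv_plus_mv_mod_rad :: "'a mv_mod_rad \<Rightarrow> 'a mv_mod_rad \<Rightarrow> 'a mv_mod_rad"
  is mv_plus by (rule mv_rad_cong_plus)

lift_definition mv_neg_mv_mod_rad :: "'a mv_mod_rad \<Rightarrow> 'a mv_mod_rad"
  is mv_neg by (rule mv_rad_cong_neg)

instance
proof
  fix x y z :: "'a mv_mod_rad"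
  show "(x \<oplus> y) \<oplus> z = x \<oplus> (y \<oplus> z)"
    by transfer (simp only: plus_assoc mv_rad_cong_refl)
  show "x \<oplus> y = y \<oplus> x"
    by transfer (subst plus_comm, rule mv_rad_cong_refl)
  show "x \<oplus> 0 = x"
    by transfer (simp only: plus_zero mv_rad_cong_refl)
  show "\<sim> (\<sim> x) = x"
    by transfer (simp only: neg_neg mv_rad_cong_refl)
  show "x \<oplus> \<sim> 0 = \<sim> 0"
    by transfer (simp only: plus_neg_zero mv_rad_cong_refl)
  show "\<sim> (\<sim> x \<oplus> y) \<oplus> y = \<sim> (\<sim> y \<oplus> x) \<oplus> x"
    by transfer (subst lukasiewicz, rule mv_rad_cong_refl)
qed

end


section \<open>Linear maps and bimorphisms\<close>

definition mv_linear :: "('a::mv_algebra \<Rightarrow> 'b::mv_algebra) \<Rightarrow> bool"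
  where "mv_linear f \<longleftrightarrow>
    (\<forall>x y. mv_summable x y \<longrightarrow> mv_summable (f x) (f y) \<and> f (x \<oplus> y) = f x \<oplus> f y)"

definition mv_bilinear :: "('a::mv_algebra \<Rightarrow> 'b::mv_algebra \<Rightarrow> 'c::mv_algebra) \<Rightarrow> bool"
  where "mv_bilinear f \<longleftrightarrow> (\<forall>x. mv_linear (f x)) \<and> (\<forall>y. mv_linear (\<lambda>x. f x y))"

definition mv_lattice_hom :: "('a::mv_algebra \<Rightarrow> 'b::mv_algebra) \<Rightarrow> bool"
  where "mv_lattice_hom f \<longleftrightarrow>
    (\<forall>x y. f (mv_sup x y) = mv_sup (f x) (f y) \<and> f (mv_inf x y) = mv_inf (f x) (f y))"

definition mv_bimorphism :: "('a::mv_algebra \<Rightarrow> 'b::mv_algebra \<Rightarrow> 'c::mv_algebra) \<Rightarrow> bool"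
  where "mv_bimorphism f \<longleftrightarrow> mv_bilinear f \<and>
    (\<forall>x. mv_lattice_hom (f x)) \<and> (\<forall>y. mv_lattice_hom (\<lambda>x. f x y))"


section \<open>The MV-algebra tensor product\<close>

text \<open>
  \<open>('a, 'b) mv_tensor\<close> is the MV-algebra presented by generators \<open>x \<otimes> y\<close> subject to the
  relations that make \<open>(x, y) \<mapsto> x \<otimes> y\<close> a bimorphism with \<open>1 \<otimes> 1 = 1\<close>. This is Mundici's
  normalization: without it, the universal algebra for two copies of \<open>{0, 1}\<close> would be the free
  MV-algebra on the generator \<open>1 \<otimes> 1\<close>, and the representation of the tensor product by
  functions on a product space would fail. The universal property is
  \<open>mv_tensor_universal\<close> below.
\<close>

datatype ('a, 'b) tensor_term =
    Gen 'a 'b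
  | TZero
  | TPlus "('a, 'b) tensor_term" "('a, 'b) tensor_term"  (infixl "[+]" 65)
  | TNeg "('a, 'b) tensor_term"  ("[~] _" [81] 80)

definition t_sup :: "('a, 'b) tensor_term \<Rightarrow> ('a, 'b) tensor_term \<Rightarrow> ('a, 'b) tensor_term"
  where "t_sup s t = [~] ([~] s [+] t) [+] t"

definition t_inf :: "('a, 'b) tensor_term \<Rightarrow> ('a, 'b) tensor_term \<Rightarrow> ('a, 'b) tensor_term"
  where "t_inf s t = [~] (t_sup ([~] s) ([~] t))"

text \<open>The rules \<open>sum_left_def\<close> and \<open>sum_right_def\<close> say that the partial sum of the two generators is defined.\<close>

inductive tensor_eq ::
    "('a::mv_algebra, 'b::mv_algebra) tensor_term \<Rightarrow> ('a, 'b) tensor_term \<Rightarrow> bool"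
  where
    refl: "tensor_eq s s"
  | sym: "tensor_eq s t \<Longrightarrow> tensor_eq t s"
  | trans: "tensor_eq s t \<Longrightarrow> tensor_eq t u \<Longrightarrow> tensor_eq s u"
  | cong_plus: "tensor_eq s s' \<Longrightarrow> tensor_eq t t' \<Longrightarrow> tensor_eq (s [+] t) (s' [+] t')"
  | cong_neg: "tensor_eq s s' \<Longrightarrow> tensor_eq ([~] s) ([~] s')"
  | assoc: "tensor_eq ((s [+] t) [+] u) (s [+] (t [+] u))"
  | comm: "tensor_eq (s [+] t) (t [+] s)"
  | zero: "tensor_eq (s [+] TZero) s"
  | dneg: "tensor_eq ([~] ([~] s)) s"
  | one: "tensor_eq (s [+] [~] TZero) ([~] TZero)"
  | luk: "tensor_eq ([~] ([~] s [+] t) [+] t) ([~] ([~] t [+] s) [+] s)"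
  | unit: "tensor_eq (Gen \<one> \<one>) ([~] TZero)"
  | sum_left_def: "mv_summable x x' \<Longrightarrow> tensor_eq ([~] (Gen x y) [+] [~] (Gen x' y)) ([~] TZero)"
  | sum_left: "mv_summable x x' \<Longrightarrow> tensor_eq (Gen (x \<oplus> x') y) (Gen x y [+] Gen x' y)"
  | sum_right_def: "mv_summable y y' \<Longrightarrow> tensor_eq ([~] (Gen x y) [+] [~] (Gen x y')) ([~] TZero)"
  | sum_right: "mv_summable y y' \<Longrightarrow> tensor_eq (Gen x (y \<oplus> y')) (Gen x y [+] Gen x y')"
  | sup_left: "tensor_eq (Gen (mv_sup x x') y) (t_sup (Gen x y) (Gen x' y))"
  | inf_left: "tensor_eq (Gen (mv_inf x x') y) (t_inf (Gen x y) (Gen x' y))"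
  | sup_right: "tensor_eq (Gen x (mv_sup y y')) (t_sup (Gen x y) (Gen x y'))"
  | inf_right: "tensor_eq (Gen x (mv_inf y y')) (t_inf (Gen x y) (Gen x y'))"

quotient_type (overloaded) ('a, 'b) mv_tensor =
    "('a::mv_algebra, 'b::mv_algebra) tensor_term" / tensor_eq
  by (intro equivpI reflpI sympI transpI)
    (fact tensor_eq.refl, fact tensor_eq.sym, fact tensor_eq.trans)

instantiation mv_tensor :: (mv_algebra, mv_algebra) mv_algebra
begin

lift_definition zero_mv_tensor :: "('a, 'b) mv_tensor" is TZero .

lift_definition mv_plus_mv_tensor ::
    "('a, 'b) mv_tensor \<Rightarrow> ('a, 'b) mv_tensor \<Rightarrow> ('a, 'b) mv_tensor"
  is TPlus by (rule tensor_eq.cong_plus)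

lift_definition mv_neg_mv_tensor :: "('a, 'b) mv_tensor \<Rightarrow> ('a, 'b) mv_tensor"
  is TNeg by (rule tensor_eq.cong_neg)

instance
  by standard (transfer, rule tensor_eq.assoc tensor_eq.comm tensor_eq.zero tensor_eq.dneg
      tensor_eq.one tensor_eq.luk)+

end

lift_definition mv_tensor_gen ::
    "'a::mv_algebra \<Rightarrow> 'b::mv_algebra \<Rightarrow> ('a, 'b) mv_tensor"  (infix "\<otimes>" 70)
  is Gen .

lemma mv_tensor_gen_one: "(\<one> :: 'a::mv_algebra) \<otimes> (\<one> :: 'b::mv_algebra) = \<one>"
  unfolding mv_one_def[where 'a = "('a, 'b) mv_tensor"] by transfer (rule tensor_eq.unit)

lemma mv_bimorphism_gen:
  "mv_bimorphism ((\<otimes>) :: 'a::mv_algebra \<Rightarrow> 'b::mv_algebra \<Rightarrow> ('a, 'b) mv_tensor)"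
proof -
  have 1: "(x \<oplus> x') \<otimes> y = x \<otimes> y \<oplus> x' \<otimes> y"
    if "mv_summable x x'" for x x' :: 'a and y :: 'b
    using that by transfer (rule tensor_eq.sum_left)
  have 7: "mv_summable (x \<otimes> y) (x' \<otimes> y)"
    if "mv_summable x x'" for x x' :: 'a and y :: 'b
    using that unfolding mv_summable_def[where 'a = "('a, 'b) mv_tensor"]
      mv_le_def[where 'a = "('a, 'b) mv_tensor"] mv_one_def[where 'a = "('a, 'b) mv_tensor"]
    by transfer (rule tensor_eq.sum_left_def)
  have 2: "x \<otimes> (y \<oplus> y') = x \<otimes> y \<oplus> x \<otimes> y'"
    if "mv_summable y y'" for x :: 'a and y y' :: 'b
    using that by transfer (rule tensor_eq.sum_right)
  have 8: "mv_summable (x \<otimes> y) (x \<otimes> y')"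
    if "mv_summable y y'" for x :: 'a and y y' :: 'b
    using that unfolding mv_summable_def[where 'a = "('a, 'b) mv_tensor"]
      mv_le_def[where 'a = "('a, 'b) mv_tensor"] mv_one_def[where 'a = "('a, 'b) mv_tensor"]
    by transfer (rule tensor_eq.sum_right_def)
  have 3: "mv_sup x x' \<otimes> y = mv_sup (x \<otimes> y) (x' \<otimes> y)"
    for x x' :: 'a and y :: 'b
    unfolding mv_sup_def[where 'a = "('a, 'b) mv_tensor"]
    by transfer (rule tensor_eq.sup_left[unfolded t_sup_def])
  have 4: "mv_inf x x' \<otimes> y = mv_inf (x \<otimes> y) (x' \<otimes> y)"
    for x x' :: 'a and y :: 'b
    unfolding mv_sup_def[where 'a = "('a, 'b) mv_tensor"] mv_inf_def[where 'a = "('a, 'b) mv_tensor"]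
    by transfer (rule tensor_eq.inf_left[unfolded t_sup_def t_inf_def])
  have 5: "x \<otimes> mv_sup y y' = mv_sup (x \<otimes> y) (x \<otimes> y')"
    for x :: 'a and y y' :: 'b
    unfolding mv_sup_def[where 'a = "('a, 'b) mv_tensor"]
    by transfer (rule tensor_eq.sup_right[unfolded t_sup_def])
  have 6: "x \<otimes> mv_inf y y' = mv_inf (x \<otimes> y) (x \<otimes> y')"
    for x :: 'a and y y' :: 'b
    unfolding mv_sup_def[where 'a = "('a, 'b) mv_tensor"] mv_inf_def[where 'a = "('a, 'b) mv_tensor"]
    by transfer (rule tensor_eq.inf_right[unfolded t_sup_def t_inf_def])
  show ?thesis
    unfolding mv_bimorphism_def mv_bilinear_def mv_linear_def mv_lattice_hom_def
    using 1 2 3 4 5 6 7 8 by simp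
qed

primrec t_eval ::
    "('a \<Rightarrow> 'b \<Rightarrow> 'c::mv_algebra) \<Rightarrow> ('a, 'b) tensor_term \<Rightarrow> 'c"
  where
    "t_eval f (Gen x y) = f x y"
  | "t_eval f TZero = 0"
  | "t_eval f (s [+] t) = t_eval f s \<oplus> t_eval f t"
  | "t_eval f ([~] s) = \<sim> (t_eval f s)"

lemma t_eval_cong:
  fixes f :: "'a::mv_algebra \<Rightarrow> 'b::mv_algebra \<Rightarrow> 'c::mv_algebra"
  assumes f: "mv_bimorphism f" and f1: "f \<one> \<one> = \<one>"
    and st: "tensor_eq s t"
  shows "t_eval f s = t_eval f t"
proof -
  have bil: "mv_bilinear f"
    and lat: "mv_lattice_hom (f x)" "mv_lattice_hom (\<lambda>x. f x y)" for x y
    using f by (auto simp: mv_bimorphism_def)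
  have R: "mv_summable (f x y) (f x y') \<and> f x (y \<oplus> y') = f x y \<oplus> f x y'"
    if "mv_summable y y'" for x y y'
    using bil that by (auto simp: mv_bilinear_def mv_linear_def)
  have L: "mv_summable (f x y) (f x' y) \<and> f (x \<oplus> x') y = f x y \<oplus> f x' y"
    if "mv_summable x x'" for x x' y
    using bil that by (auto simp: mv_bilinear_def mv_linear_def)
  show ?thesis
    using st
  proof induction
    case (assoc s t u) then show ?case by (simp add: plus_assoc)
  next
    case (comm s t) then show ?case by (simp add: plus_comm)
  next
    case (luk s t) then show ?case by (simp add: lukasiewicz)
  next
    case (sum_left_def x x' y)
    then show ?case using L[of x x' y] by (simp add: mv_summable_def mv_le_def mv_one_def)
  next
    case (sum_right_def y y' x)
    then show ?case using R[of y y' x] by (simp add: mv_summable_def mv_le_def mv_one_def)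
  qed (use L R lat f1 in \<open>auto simp: plus_zero neg_neg plus_neg_zero mv_one_def
        t_sup_def t_inf_def mv_lattice_hom_def mv_sup_def[where 'a = 'c] mv_inf_def[where 'a = 'c]\<close>)
qed

theorem mv_tensor_universal:
  fixes f :: "'a::mv_algebra \<Rightarrow> 'b::mv_algebra \<Rightarrow> 'c::mv_algebra"
  assumes "mv_bimorphism f" and "f \<one> \<one> = \<one>"
  shows "\<exists>!h :: ('a, 'b) mv_tensor \<Rightarrow> 'c. mv_hom h \<and> (\<forall>x y. h (x \<otimes> y) = f x y)"
proof -
  define h where "h u = t_eval f (rep_mv_tensor u)" for u
  have h_abs: "h (abs_mv_tensor t) = t_eval f t" for t
    unfolding h_def
    by (intro t_eval_cong[OF assms] Quotient3_rep_abs[OF Quotient3_mv_tensor] tensor_eq.refl)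
  have ex: "mv_hom h" "h (x \<otimes> y) = f x y" for x y
  proof -
    have "h (u \<oplus> v) = h u \<oplus> h v" for u v
      by (induction u rule: mv_tensor.abs_induct, induction v rule: mv_tensor.abs_induct)
        (simp add: mv_plus_mv_tensor.abs_eq h_abs)
    moreover have "h (\<sim> u) = \<sim> (h u)" for u
      by (induction u rule: mv_tensor.abs_induct) (simp add: mv_neg_mv_tensor.abs_eq h_abs)
    ultimately show "mv_hom h"
      by (simp add: mv_hom_def zero_mv_tensor_def h_abs)
    show "h (x \<otimes> y) = f x y"
      by (simp add: mv_tensor_gen.abs_eq h_abs)
  qed
  have uniq: "k = h" if k: "mv_hom k" "\<And>x y. k (x \<otimes> y) = f x y" for k
  proof
    fix u
    have "k (abs_mv_tensor t) = t_eval f t" for t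
    proof (induction t)
      case (Gen x y)
      then show ?case using k(2)[of x y] by (simp add: mv_tensor_gen.abs_eq)
    next
      case TZero
      then show ?case using k(1) by (simp add: mv_hom_def zero_mv_tensor_def)
    next
      case (TPlus s t)
      then show ?case using k(1) by (simp add: mv_hom_def flip: mv_plus_mv_tensor.abs_eq)
    next
      case (TNeg t)
      then show ?case using k(1) by (simp add: mv_hom_def flip: mv_neg_mv_tensor.abs_eq)
    qed
    then show "k u = h u" by (induction u rule: mv_tensor.abs_induct) (simp add: h_abs)
  qed
  show ?thesis
  proof (rule ex1I[of _ h])
    show "mv_hom h \<and> (\<forall>x y. h (x \<otimes> y) = f x y)"
      by (intro conjI allI ex)
    show "k = h" if "mv_hom k \<and> (\<forall>x y. k (x \<otimes> y) = f x y)" for k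
      by (rule uniq) (simp_all add: that)
  qed
qed

type_synonym ('a, 'b) mv_ss_tensor = "('a, 'b) mv_tensor mv_mod_rad"


section \<open>PMV-algebras and MV-modules\<close>

text \<open>The axioms \<open>mult_linear_right\<close> and \<open>mult_linear_left\<close> say that the product is bilinear;
  see \<open>mv_bilinear_mult\<close>.\<close>

class unital_pmv_algebra = mv_algebra + times +
  assumes mult_assoc: "(x * y) * z = x * (y * z)"
    and mult_one_left: "\<one> * x = x"
    and mult_one_right: "x * \<one> = x"
    and mult_linear_right: "mv_summable y z \<Longrightarrow>
      mv_summable (x * y) (x * z) \<and> x * (y \<oplus> z) = x * y \<oplus> x * z"
    and mult_linear_left: "mv_summable x y \<Longrightarrow>
      mv_summable (x * z) (y * z) \<and> (x \<oplus> y) * z = x * z \<oplus> y * z"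

lemma mv_bilinear_mult:
  "mv_bilinear ((*) :: 'a::unital_pmv_algebra \<Rightarrow> 'a \<Rightarrow> 'a)"
  by (simp add: mv_bilinear_def mv_linear_def mult_linear_left mult_linear_right)

definition mv_module :: "('p::unital_pmv_algebra \<Rightarrow> 'm::mv_algebra \<Rightarrow> 'm) \<Rightarrow> bool"
  where "mv_module act \<longleftrightarrow> mv_bilinear act \<and>
    (\<forall>a b x. act (a * b) x = act a (act b x)) \<and> (\<forall>x. act \<one> x = x)"

end

theory Submission
  imports Defs Complex_Main
begin

text \<open>
  Every maximal ideal is the kernel of a \<open>[0,1]\<close>-valued character, so an MV-algebra modulo its
  radical embeds into a power of \<open>[0,1]\<close>. An additive nonnegative map dominated by a character
  \<open>\<phi>\<close> is a multiple of \<open>\<phi>\<close>; hence characters of \<open>A\<close> are multiplicative, and a character \<open>k\<close>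
  of the tensor product satisfies \<open>k ((a x) \<otimes> y) = k (a \<otimes> 1) k (x \<otimes> y)\<close>. Thus the functions that
  remain in the algebra after multiplication by \<open>a \<otimes> 1\<close> include the generators and are closed
  under the operations, and pointwise multiplication by \<open>a \<otimes> 1\<close> is the required action. Both
  additivity of the characters and uniqueness of dominated maps are proved by doubling: the
  doubling map reproduces the error of the claimed identity with twice its size, while errors are
  bounded, so they vanish.
\<close>

section \<open>Differences in MV-algebras\<close>

context mv_algebra
begin

lemma zero_plus: "0 \<oplus> x = x"
  using plus_comm plus_zero by metis

lemma mv_diff_mv_diff: "mv_diff (mv_diff x y) z = mv_diff x (y \<oplus> z)"
  by (simp add: mv_diff_def neg_neg plus_assoc)

lemma mv_diff_le: "mv_diff x y \<preceq> x"
  by (metis mv_diff_le_iff mv_le_iff plus_comm)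

lemma mv_diff_neg_neg: "mv_diff (\<sim> x) (\<sim> y) = mv_diff y x"
  by (simp add: mv_diff_def neg_neg plus_comm)

lemma mv_neg_plus: "\<sim> (x \<oplus> y) = mv_diff (\<sim> x) y"
  by (simp add: mv_diff_def neg_neg)

lemma mv_diff_self: "mv_diff x x = 0"
  by (metis mv_diff_def neg_plus_self mv_one_def neg_neg)

lemma mv_le_0: "x \<preceq> 0 \<Longrightarrow> x = 0"
  by (metis mv_le_def plus_zero mv_one_def neg_neg)

lemma mv_zero_le: "0 \<preceq> x"
  by (metis mv_le_iff plus_comm plus_zero)

text \<open>The right-hand side is the meet of \<open>x\<close> and \<open>\<sim> y\<close>, so
  subtracting \<open>y\<close> again loses exactly the overflow of the sum. The reason is the
  Lukasiewicz axiom at \<open>\<sim> x\<close> and \<open>y\<close>.\<close>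

lemma mv_plus_diff_cancel: "mv_diff (x \<oplus> y) y = mv_diff x (mv_diff x (\<sim> y))"
proof -
  have "\<sim> (x \<oplus> y) \<oplus> y = \<sim> (\<sim> y \<oplus> \<sim> x) \<oplus> \<sim> x"
    using lukasiewicz[of "\<sim> x" y] by (simp add: neg_neg)
  then show ?thesis
    by (simp add: mv_diff_def plus_comm)
qed

lemma mv_diff_diff_le: "mv_diff x (mv_diff x y) \<preceq> y"
  using mv_diff_le_iff mv_le_plus_diff plus_comm by metis

lemma mv_inf_diff: "mv_inf x y = mv_diff x (mv_diff x y)"
  unfolding mv_inf_def mv_sup_def mv_diff_def
  by (metis neg_neg plus_comm lukasiewicz)

lemma mv_diff_comm: "mv_diff x (mv_diff x y) = mv_diff y (mv_diff y x)"
  unfolding mv_diff_def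
  by (metis neg_neg plus_comm lukasiewicz)

lemma mv_sup_diff: "x \<oplus> mv_diff y x = y \<oplus> mv_diff x y"
  using lukasiewicz[of y x] by (simp add: mv_diff_def plus_comm)

lemma mv_diff_left_comm: "mv_diff (mv_diff x y) z = mv_diff (mv_diff x z) y"
  by (simp add: mv_diff_mv_diff plus_comm)

lemma mv_diff_mono: "x \<preceq> y \<Longrightarrow> mv_diff x z \<preceq> mv_diff y z"
  using mv_diff_le_iff mv_le_plus_diff mv_le_trans by metis

text \<open>Prelinearity: the left-hand side is the meet of \<open>mv_diff x y\<close> and
  \<open>mv_diff y x\<close>. This makes the order modulo a maximal ideal total. The meet lies below
  \<open>mv_diff b d\<close>, and removing \<open>d\<close> from \<open>y\<close> leaves at most
  \<open>e\<close>, which is below \<open>x\<close>.\<close>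

lemma mv_diff_prelinear: "mv_diff (mv_diff x y) (mv_diff (mv_diff x y) (mv_diff y x)) = 0"
proof -
  define b where "b = mv_diff y x"
  define e where "e = mv_diff x b"
  define d where "d = mv_diff y e"
  have "mv_diff (mv_diff x y) (mv_diff (mv_diff x y) b) = mv_diff x (y \<oplus> mv_diff e y)"
    by (simp add: mv_diff_mv_diff e_def plus_comm)
  also have "\<dots> = mv_diff (mv_diff x e) d"
    by (simp add: mv_sup_diff mv_diff_mv_diff d_def)
  also have "\<dots> = mv_diff (mv_diff b (mv_diff b x)) d"
    by (simp add: e_def mv_diff_comm)
  finally have 1: "mv_diff (mv_diff x y) (mv_diff (mv_diff x y) b) \<preceq> mv_diff b d"
    using mv_diff_mono mv_diff_le by metis
  have "mv_diff b d = mv_diff (mv_diff y d) x"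
    by (simp add: b_def mv_diff_left_comm)
  also have "\<dots> \<preceq> mv_diff e x"
    unfolding d_def by (intro mv_diff_mono mv_diff_diff_le)
  also have "\<dots> = 0"
    using mv_diff_left_comm mv_diff_self mv_le_0 mv_diff_le unfolding e_def by metis
  finally show ?thesis
    using 1 mv_le_0 b_def by metis
qed

end


section \<open>Hoelder's theorem: maximal ideals are kernels of real characters\<close>

text \<open>Iteration bounds \<open>e\<close> by \<open>B / 2 ^ n\<close> on all of
  \<open>S\<close>. In every doubling argument \<open>S\<close> collects the instances of a claim
  and \<open>e\<close> measures the error.\<close>

lemma le_0_if_le_half:
  fixes e :: "'i \<Rightarrow> real"
  assumes "\<And>i. i \<in> S \<Longrightarrow> \<exists>j\<in>S. e i \<le> e j / 2"
    and bounded: "\<And>i. i \<in> S \<Longrightarrow> e i \<le> B"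
    and "i \<in> S"
  shows "e i \<le> 0"
proof -
  have "\<forall>i\<in>S. e i \<le> B / 2 ^ n" for n
  proof (induction n)
    case 0
    then show ?case using bounded by simp
  next
    case (Suc n)
    show ?case
    proof
      fix i assume "i \<in> S"
      then obtain j where "j \<in> S" "e i \<le> e j / 2" using assms(1) by blast
      then show "e i \<le> B / 2 ^ Suc n" using Suc by fastforce
    qed
  qed
  moreover have "(\<lambda>n. B / 2 ^ n) \<longlonglongrightarrow> 0"
    by (rule LIMSEQ_divide_realpow_zero) simp
  ultimately show ?thesis
    using \<open>i \<in> S\<close> by (intro Lim_bounded2[of _ 0 0]) auto
qed

text \<open>A homomorphism into the standard MV-algebra \<open>[0,1]\<close>; the codomain is
  \<open>real\<close> for the sake of arithmetic, and the clauses force the values into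
  \<open>[0,1]\<close>.\<close>

definition mv_character :: "('a::mv_algebra \<Rightarrow> real) \<Rightarrow> bool"
  where "mv_character h \<longleftrightarrow> h 0 = 0 \<and>
    (\<forall>x y. h (x \<oplus> y) = min 1 (h x + h y)) \<and> (\<forall>x. h (\<sim> x) = 1 - h x)"

text \<open>The relation \<open>\<sqsubseteq>\<close> is the order of the quotient by \<open>M\<close>, pulled back to the algebra.\<close>

locale mv_maximal =
  fixes M :: "'a::mv_algebra set"
  assumes maximal: "mv_maximal_ideal M"
begin

definition le :: "'a \<Rightarrow> 'a \<Rightarrow> bool"  (infix "\<sqsubseteq>" 50)
  where "x \<sqsubseteq> y \<longleftrightarrow> mv_diff x y \<in> M"

definition eqv :: "'a \<Rightarrow> 'a \<Rightarrow> bool"  (infix "\<approx>" 50)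
  where "x \<approx> y \<longleftrightarrow> x \<sqsubseteq> y \<and> y \<sqsubseteq> x"

section \<open>Order and congruence modulo \<open>M\<close>\<close>

lemma zero_mem: "0 \<in> M"
  and plus_mem: "x \<in> M \<Longrightarrow> y \<in> M \<Longrightarrow> x \<oplus> y \<in> M"
  and le_mem: "x \<preceq> y \<Longrightarrow> y \<in> M \<Longrightarrow> x \<in> M"
proof -
  have M: "mv_ideal M" using maximal by (simp add: mv_maximal_ideal_def)
  show "0 \<in> M" using M by (simp add: mv_ideal_def)
  show "x \<in> M \<Longrightarrow> y \<in> M \<Longrightarrow> x \<oplus> y \<in> M" using M by (simp add: mv_ideal_def)
  show "x \<preceq> y \<Longrightarrow> y \<in> M \<Longrightarrow> x \<in> M" using M unfolding mv_ideal_def by metis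
qed

lemma one_not_mem: "\<one> \<notin> M"
  using maximal le_mem mv_le_iff one_plus(2) plus_comm
  unfolding mv_maximal_ideal_def by (metis UNIV_eq_I)

lemma le_zero_iff: "x \<sqsubseteq> 0 \<longleftrightarrow> x \<in> M"
  by (simp add: le_def mv_diff_def plus_zero neg_neg)

lemma leI: "x \<preceq> y \<Longrightarrow> x \<sqsubseteq> y"
  by (metis le_def mv_le_def mv_diff_def mv_one_def neg_neg zero_mem)

lemma le_refl: "x \<sqsubseteq> x"
  by (simp add: leI mv_le_refl)

lemma le_trans [trans]: "x \<sqsubseteq> y \<Longrightarrow> y \<sqsubseteq> z \<Longrightarrow> x \<sqsubseteq> z"
  unfolding le_def using le_mem plus_mem mv_diff_triangle by blast

lemma le_plus: "x \<sqsubseteq> x' \<Longrightarrow> y \<sqsubseteq> y' \<Longrightarrow> x \<oplus> y \<sqsubseteq> x' \<oplus> y'"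
  unfolding le_def using le_mem plus_mem mv_diff_plus_le by blast

lemma le_neg: "\<sim> x \<sqsubseteq> \<sim> y \<longleftrightarrow> y \<sqsubseteq> x"
  by (simp add: le_def mv_diff_neg_neg)

lemma le_neg_comm: "x \<sqsubseteq> \<sim> y \<Longrightarrow> y \<sqsubseteq> \<sim> x"
  by (metis le_neg neg_neg)

lemma neg_le_comm: "\<sim> x \<sqsubseteq> y \<Longrightarrow> \<sim> y \<sqsubseteq> x"
  by (metis le_neg neg_neg)

lemma le_diff: "x \<sqsubseteq> x' \<Longrightarrow> y' \<sqsubseteq> y \<Longrightarrow> mv_diff x y \<sqsubseteq> mv_diff x' y'"
  by (simp add: mv_diff_def le_neg le_plus)

lemma diff_le_iff: "mv_diff x y \<sqsubseteq> z \<longleftrightarrow> x \<sqsubseteq> y \<oplus> z"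
  by (simp add: le_def mv_diff_mv_diff)

lemma le_plus_left: "x \<sqsubseteq> x \<oplus> y" and le_plus_right: "x \<sqsubseteq> y \<oplus> x"
  by (metis leI mv_le_iff plus_comm)+

lemma le_one: "x \<sqsubseteq> \<one>"
  by (metis le_plus_left one_plus(2))

lemma not_one_le_zero: "\<not> \<one> \<sqsubseteq> 0"
  by (simp add: le_zero_iff one_not_mem)

text \<open>By maximality the ideal \<open>I\<close> generated by \<open>M\<close> and
  \<open>x\<close> is everything, so \<open>\<one>\<close> lies below a member of \<open>M\<close>
  plus a multiple of \<open>x\<close>.\<close>

lemma archimedean:
  assumes "x \<notin> M"
  obtains n where "\<one> \<sqsubseteq> ((\<oplus>) x ^^ n) 0"
proof -
  define I where "I = {t. \<exists>m\<in>M. \<exists>n. t \<preceq> m \<oplus> ((\<oplus>) x ^^ n) 0}"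
  have add: "((\<oplus>) x ^^ (n + k)) 0 = ((\<oplus>) x ^^ n) 0 \<oplus> ((\<oplus>) x ^^ k) 0" for n k
    by (induction n) (auto simp: plus_assoc plus_zero zero_plus)
  have "mv_ideal I"
    unfolding mv_ideal_def
  proof (intro conjI ballI allI impI)
    show "0 \<in> I" unfolding I_def using zero_mem mv_zero_le by blast
    fix t u
    show "t \<oplus> u \<in> I" if tI: "t \<in> I" and uI: "u \<in> I"
    proof -
      from tI obtain m n where t: "m \<in> M" "t \<preceq> m \<oplus> ((\<oplus>) x ^^ n) 0" unfolding I_def by blast
      from uI obtain m' n' where u: "m' \<in> M" "u \<preceq> m' \<oplus> ((\<oplus>) x ^^ n') 0" unfolding I_def by blast
      have "t \<oplus> u \<preceq> (m \<oplus> ((\<oplus>) x ^^ n) 0) \<oplus> (m' \<oplus> ((\<oplus>) x ^^ n') 0)"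
        using t(2) u(2) mv_plus_mono mv_le_trans plus_comm by metis
      then have "t \<oplus> u \<preceq> (m \<oplus> m') \<oplus> ((\<oplus>) x ^^ (n + n')) 0"
        by (simp add: add plus_ac)
      then show ?thesis unfolding I_def using plus_mem t(1) u(1) by blast
    qed
    show "t \<in> I" if "t \<preceq> u \<and> u \<in> I"
      using that mv_le_trans unfolding I_def by blast
  qed
  moreover have "M \<subseteq> I"
  proof
    fix m assume "m \<in> M"
    moreover have "m \<preceq> m \<oplus> ((\<oplus>) x ^^ 0) 0" by (simp add: plus_zero mv_le_refl)
    ultimately show "m \<in> I" unfolding I_def by blast
  qed
  moreover have "x \<in> I"
  proof -
    have "x \<preceq> 0 \<oplus> ((\<oplus>) x ^^ 1) 0" by (simp add: plus_zero zero_plus mv_le_refl)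
    then show ?thesis unfolding I_def using zero_mem by blast
  qed
  ultimately have "\<one> \<in> I"
    using maximal assms unfolding mv_maximal_ideal_def by blast
  then obtain m n where m: "m \<in> M" "\<one> \<preceq> m \<oplus> ((\<oplus>) x ^^ n) 0" unfolding I_def by blast
  then have "mv_diff \<one> (((\<oplus>) x ^^ n) 0) \<preceq> m"
    by (simp add: mv_diff_le_iff plus_comm)
  then show thesis using that m(1) le_mem le_def by blast
qed

text \<open>If \<open>b\<close> is not in \<open>M\<close>, some multiple of \<open>b\<close> is
  \<open>\<one>\<close> modulo \<open>M\<close>. By prelinearity \<open>a\<close> is disjoint from
  \<open>b\<close>, hence survives the subtraction of any multiple of \<open>b\<close>, and so
  vanishes modulo \<open>M\<close>.\<close>

lemma le_total: "x \<sqsubseteq> y \<or> y \<sqsubseteq> x"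
proof (rule disjCI)
  define a where "a = mv_diff x y"
  define b where "b = mv_diff y x"
  assume "\<not> y \<sqsubseteq> x"
  then obtain n where n: "\<one> \<sqsubseteq> ((\<oplus>) b ^^ n) 0" using archimedean unfolding b_def le_def by blast
  have ab: "a \<preceq> mv_diff a b"
    using mv_diff_prelinear[of x y] unfolding a_def b_def
    by (metis mv_diff_def mv_le_def neg_neg mv_one_def)
  have "a \<preceq> mv_diff a (((\<oplus>) b ^^ k) 0)" for k
  proof (induction k)
    case 0
    then show ?case by (simp add: mv_diff_def plus_zero neg_neg mv_le_refl)
  next
    case (Suc k)
    then show ?case
      using mv_diff_mono[OF ab, of "((\<oplus>) b ^^ k) 0"] mv_le_trans
      by (simp add: mv_diff_mv_diff) blast
  qed
  then have "a \<sqsubseteq> mv_diff a (((\<oplus>) b ^^ n) 0)" by (rule leI)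
  also have "\<dots> \<sqsubseteq> mv_diff \<one> \<one>"
    by (intro le_diff le_one n)
  finally show "x \<sqsubseteq> y"
    by (simp add: le_zero_iff mv_diff_self a_def le_def[of x y])
qed

section \<open>Partial addition modulo \<open>M\<close>\<close>

lemma le_plus_diff_cancel: "x \<sqsubseteq> \<sim> y \<Longrightarrow> x \<sqsubseteq> mv_diff (x \<oplus> y) y"
  \<comment> \<open>What \<open>x\<close> loses is \<open>x\<close> minus its meet with
    \<open>\<sim> y\<close>; this is below \<open>mv_diff x (\<sim> y)\<close>, which is in
    \<open>M\<close>.\<close>
  unfolding mv_plus_diff_cancel le_def by (rule le_mem[OF mv_diff_diff_le])

lemma plus_diff_le: "mv_diff (x \<oplus> y) y \<sqsubseteq> x"
  by (simp add: diff_le_iff le_refl plus_comm[of y])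

lemma eqv_refl: "x \<approx> x"
  and eqv_sym: "x \<approx> y \<Longrightarrow> y \<approx> x"
  and eqv_plus: "x \<approx> x' \<Longrightarrow> y \<approx> y' \<Longrightarrow> x \<oplus> y \<approx> x' \<oplus> y'"
  and eqv_diff: "x \<approx> x' \<Longrightarrow> y \<approx> y' \<Longrightarrow> mv_diff x y \<approx> mv_diff x' y'"
  and eqv_neg: "x \<approx> y \<Longrightarrow> \<sim> x \<approx> \<sim> y"
  and plus_diff_eqv: "x \<sqsubseteq> \<sim> y \<Longrightarrow> mv_diff (x \<oplus> y) y \<approx> x"
  unfolding eqv_def
  by (simp_all add: le_refl le_neg le_plus le_diff plus_diff_le le_plus_diff_cancel)

lemma eqv_trans [trans]: "x \<approx> y \<Longrightarrow> y \<approx> z \<Longrightarrow> x \<approx> z"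
  unfolding eqv_def using le_trans by blast

text \<open>The left-hand side is the join, which also equals \<open>y \<oplus> mv_diff x y\<close>,
  and \<open>mv_diff x y\<close> is in \<open>M\<close>.\<close>

lemma plus_diff_absorb: "x \<sqsubseteq> y \<Longrightarrow> x \<oplus> mv_diff y x \<approx> y"
  unfolding eqv_def
  using le_plus[OF le_refl[of y], of "mv_diff x y" 0] leI[OF mv_le_plus_diff]
  by (simp add: mv_sup_diff[of x y] le_zero_iff le_def[of x y] plus_zero le_plus_left)

text \<open>The definedness half of associativity for partial sums: subtracting \<open>v\<close>
  from \<open>u \<oplus> v \<sqsubseteq> \<sim> w\<close> recovers \<open>u\<close> on the left and
  leaves \<open>\<sim> (v \<oplus> w)\<close> on the right.\<close>

lemma summable_assoc:
  assumes "u \<sqsubseteq> \<sim> v" "u \<oplus> v \<sqsubseteq> \<sim> w"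
  shows "v \<sqsubseteq> \<sim> w" and "u \<sqsubseteq> \<sim> (v \<oplus> w)"
proof -
  show "v \<sqsubseteq> \<sim> w" using assms(2) le_plus_right le_trans by blast
  have "u \<sqsubseteq> mv_diff (\<sim> w) v"
    using le_plus_diff_cancel[OF assms(1)] le_diff[OF assms(2) le_refl] le_trans by blast
  then show "u \<sqsubseteq> \<sim> (v \<oplus> w)" by (simp add: mv_neg_plus[symmetric] plus_comm)
qed

text \<open>\<open>tri x y z\<close> says that \<open>x + y + z = 1\<close> in the quotient; this form of additivity is
  symmetric in the three variables.\<close>

definition tri :: "'a \<Rightarrow> 'a \<Rightarrow> 'a \<Rightarrow> bool"
  where "tri x y z \<longleftrightarrow> x \<sqsubseteq> \<sim> y \<and> z \<approx> \<sim> (x \<oplus> y)"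

lemma tri_swap12: "tri x y z \<Longrightarrow> tri y x z"
  unfolding tri_def using le_neg_comm by (metis plus_comm)

text \<open>Together with \<open>tri_swap12\<close> this generates all permutations of the
  entries.\<close>

lemma tri_swap23:
  assumes "tri x y z"
  shows "tri x z y"
proof -
  have xy: "y \<sqsubseteq> \<sim> x" and z: "z \<sqsubseteq> \<sim> (x \<oplus> y)" "\<sim> (x \<oplus> y) \<sqsubseteq> z"
    using assms le_neg_comm by (auto simp: tri_def eqv_def)
  have "z \<sqsubseteq> \<sim> x"
    using z(1) by (rule le_trans) (simp add: le_neg le_plus_left)
  then have "x \<sqsubseteq> \<sim> z" by (rule le_neg_comm)
  moreover have "y \<sqsubseteq> \<sim> (x \<oplus> z)"
    using summable_assoc(2)[of y x z] xy le_neg_comm[OF z(1)] by (simp add: plus_comm)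
  moreover have "\<sim> (x \<oplus> z) \<sqsubseteq> y"
    using neg_le_comm[OF z(2)] by (metis diff_le_iff mv_neg_plus plus_comm)
  ultimately show ?thesis by (simp add: tri_def eqv_def)
qed

lemma tri_neg: "tri x y z \<Longrightarrow> \<sim> z \<approx> x \<oplus> y"
  unfolding tri_def using eqv_neg neg_neg by metis

lemma tri_cong: "tri x y z \<Longrightarrow> x \<approx> x' \<Longrightarrow> y \<approx> y' \<Longrightarrow> z \<approx> z' \<Longrightarrow> tri x' y' z'"
proof -
  assume *: "tri x y z" "x \<approx> x'" "y \<approx> y'" "z \<approx> z'"
  have "x' \<sqsubseteq> \<sim> y'"
    using * le_trans eqv_neg[OF *(3)] unfolding tri_def eqv_def by blast
  moreover have "z' \<approx> \<sim> (x' \<oplus> y')"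
    using * eqv_trans eqv_sym eqv_neg[OF eqv_plus[OF *(2,3)]] unfolding tri_def by blast
  ultimately show ?thesis by (simp add: tri_def)
qed

text \<open>Expresses that \<open>x\<close> is at most 1/2, which is also the condition for
  \<open>x + x\<close> to be defined modulo \<open>M\<close>. At 1/2 both \<open>x\<close> and
  \<open>\<sim> x\<close> are low.\<close>

definition low :: "'a \<Rightarrow> bool"
  where "low x \<longleftrightarrow> x \<sqsubseteq> \<sim> x"

lemma low_mono: "x \<sqsubseteq> y \<Longrightarrow> low y \<Longrightarrow> low x"
  unfolding low_def using le_trans le_neg by blast

lemma low_neg: "\<not> low x \<Longrightarrow> low (\<sim> x)"
  unfolding low_def using le_total neg_neg by metis

text \<open>If \<open>z\<close> exceeds 1/2, then \<open>x + y = 1 - z\<close> is at most 1/2, and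
  the doubled entries \<open>2x\<close>, \<open>2y\<close>, \<open>2z - 1\<close> again sum to
  1.\<close>

lemma tri_high:
  assumes "tri x y z" "\<not> low z"
  shows "low x" "low y" "tri (x \<oplus> x) (y \<oplus> y) (\<sim> (\<sim> z \<oplus> \<sim> z))"
proof -
  have z: "\<sim> z \<approx> x \<oplus> y" using assms(1) by (rule tri_neg)
  then have xy: "low (x \<oplus> y)" using assms(2) low_neg low_mono unfolding eqv_def by blast
  then show "low x" "low y" using low_mono le_plus_left le_plus_right by blast+
  have "x \<sqsubseteq> \<sim> y" using assms(1) by (simp add: tri_def)
  \<comment> \<open>Definedness of \<open>(x + y) + (x + y)\<close> is regrouped into that of
    \<open>(x + x) + (y + y)\<close>.\<close>
  then have "y \<sqsubseteq> \<sim> (x \<oplus> y)" "x \<sqsubseteq> \<sim> (y \<oplus> (x \<oplus> y))"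
    using summable_assoc[of x y "x \<oplus> y"] xy by (auto simp: low_def)
  then have "(y \<oplus> y) \<oplus> x \<sqsubseteq> \<sim> x"
    by (simp add: le_neg_comm plus_ac)
  moreover have "y \<oplus> y \<sqsubseteq> \<sim> x"
    using calculation le_plus_left le_trans by blast
  ultimately have "x \<oplus> x \<sqsubseteq> \<sim> (y \<oplus> y)"
    using summable_assoc(2)[of "y \<oplus> y" x x] le_neg_comm by blast
  moreover have "\<sim> (\<sim> z \<oplus> \<sim> z) \<approx> \<sim> ((x \<oplus> x) \<oplus> (y \<oplus> y))"
    using eqv_neg[OF eqv_plus[OF z z]] by (simp add: plus_ac)
  ultimately show "tri (x \<oplus> x) (y \<oplus> y) (\<sim> (\<sim> z \<oplus> \<sim> z))"
    by (simp add: tri_def)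
qed

text \<open>If no entry exceeds 1/2, the entries \<open>1 - 2x\<close>, \<open>1 - 2y\<close>,
  \<open>1 - 2z\<close> sum to \<open>3 - 2 = 1\<close>. The order of \<open>x\<close> and
  \<open>y\<close> is fixed to make \<open>y - x\<close> a genuine difference;
  \<open>tri_low\<close> removes it by symmetry.\<close>

lemma tri_low_ordered:
  assumes t: "tri x y z" and low: "low x" "low y" "low z" and "x \<sqsubseteq> y"
  shows "tri (\<sim> (x \<oplus> x)) (\<sim> (y \<oplus> y)) (\<sim> (z \<oplus> z))"
proof -
  \<comment> \<open>Since \<open>x + y + z = 1\<close>, one expects \<open>1 - 2x = d + z\<close>
    and \<open>1 - 2y = r\<close>, while \<open>(d + z) + r = z + z\<close>.\<close>
  define d where "d = mv_diff y x"
  define r where "r = mv_diff z d"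
  have x: "\<sim> x \<approx> y \<oplus> z" and y: "\<sim> y \<approx> x \<oplus> z"
    using t tri_neg tri_swap12 tri_swap23 by blast+
  have xd: "x \<oplus> d \<approx> y"
    unfolding d_def by (rule plus_diff_absorb) fact
  \<comment> \<open>As \<open>y\<close> is low, it is below \<open>\<sim> y\<close>, which is
    \<open>x + z\<close>. Hence \<open>d \<sqsubseteq> z\<close>, and the subtraction in
    \<open>r\<close> is not truncated.\<close>
  have "y \<sqsubseteq> x \<oplus> z"
    using low(2) y le_trans unfolding low_def eqv_def by blast
  then have "d \<sqsubseteq> z"
    by (simp add: d_def diff_le_iff)
  then have dr: "d \<oplus> r \<approx> z"
    unfolding r_def by (rule plus_diff_absorb)
  have dy: "d \<sqsubseteq> y" and rz: "r \<sqsubseteq> z"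
    by (simp_all add: d_def r_def leI mv_diff_le)
  have a: "d \<oplus> z \<approx> \<sim> (x \<oplus> x)"
  proof -
    have "d \<oplus> z \<sqsubseteq> \<sim> x"
      using le_plus[OF dy le_refl] x le_trans unfolding eqv_def by blast
    then have "d \<oplus> z \<approx> mv_diff ((d \<oplus> z) \<oplus> x) x"
      by (rule eqv_sym[OF plus_diff_eqv])
    also have "\<dots> \<approx> mv_diff (\<sim> x) x"
    proof (intro eqv_diff eqv_refl)
      have "(d \<oplus> z) \<oplus> x = (x \<oplus> d) \<oplus> z" by (simp add: plus_ac)
      also have "\<dots> \<approx> y \<oplus> z" by (intro eqv_plus eqv_refl xd)
      also have "\<dots> \<approx> \<sim> x" using x by (rule eqv_sym)
      finally show "(d \<oplus> z) \<oplus> x \<approx> \<sim> x" .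
    qed
    finally show ?thesis by (simp add: mv_neg_plus)
  qed
  have b: "r \<approx> \<sim> (y \<oplus> y)"
  proof -
    have "z \<sqsubseteq> \<sim> y"
      using y le_plus_right le_trans unfolding eqv_def by blast
    then have "r \<approx> mv_diff (r \<oplus> y) y"
      by (rule eqv_sym[OF plus_diff_eqv[OF le_trans[OF rz]]])
    also have "\<dots> \<approx> mv_diff (\<sim> y) y"
    proof (intro eqv_diff eqv_refl)
      have "r \<oplus> y \<approx> r \<oplus> (x \<oplus> d)"
        by (intro eqv_plus eqv_refl eqv_sym[OF xd])
      also have "\<dots> = x \<oplus> (d \<oplus> r)" by (simp add: plus_ac)
      also have "\<dots> \<approx> x \<oplus> z" by (intro eqv_plus eqv_refl dr)
      also have "\<dots> \<approx> \<sim> y" using y by (rule eqv_sym)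
      finally show "r \<oplus> y \<approx> \<sim> y" .
    qed
    finally show ?thesis by (simp add: mv_neg_plus)
  qed
  have "tri (d \<oplus> z) r (\<sim> (z \<oplus> z))"
    unfolding tri_def
  proof
    have "d \<oplus> z \<sqsubseteq> d \<oplus> \<sim> z"
      using low(3) by (intro le_plus le_refl) (simp add: low_def)
    then show "d \<oplus> z \<sqsubseteq> \<sim> r"
      by (simp add: r_def mv_diff_def neg_neg plus_comm)
    have "z \<oplus> z \<approx> (d \<oplus> r) \<oplus> z"
      by (intro eqv_plus eqv_refl eqv_sym[OF dr])
    then show "\<sim> (z \<oplus> z) \<approx> \<sim> ((d \<oplus> z) \<oplus> r)"
      by (intro eqv_neg) (simp add: plus_ac)
  qed
  then show ?thesis using tri_cong a b eqv_refl by blast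
qed

lemma tri_low:
  assumes "tri x y z" "low x" "low y" "low z"
  shows "tri (\<sim> (x \<oplus> x)) (\<sim> (y \<oplus> y)) (\<sim> (z \<oplus> z))"
  using le_total[of x y] assms tri_low_ordered tri_swap12 by blast

text \<open>Binary expansion: \<open>dbl\<close> is doubling modulo \<open>1\<close>, and \<open>low\<close> decides whether the
  leading binary digit is \<open>0\<close>.\<close>

definition dbl :: "'a \<Rightarrow> 'a"
  where "dbl x = (if low x then x \<oplus> x else \<sim> (\<sim> x \<oplus> \<sim> x))"

definition digit :: "'a \<Rightarrow> real"
  where "digit x = (if low x then 0 else 1)"

definition val :: "'a \<Rightarrow> real"
  where "val x = (\<Sum>n. digit ((dbl ^^ n) x) * (1 / 2) ^ Suc n)"

lemma digit_bounds: "0 \<le> digit x" "digit x \<le> 1"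
  by (auto simp: digit_def)

section \<open>Convergence and recursion of the binary expansion\<close>

lemma half_power_sums: "(\<lambda>n. (1 / 2 :: real) ^ Suc n) sums 1"
  using power_half_series by simp

lemma val_summable: "summable (\<lambda>n. digit ((dbl ^^ n) x) * (1 / 2) ^ Suc n)"
proof (rule summable_comparison_test)
  show "\<exists>N. \<forall>n\<ge>N. norm (digit ((dbl ^^ n) x) * (1 / 2) ^ Suc n) \<le> (1 / 2) ^ Suc n"
    using digit_bounds by (intro exI[of _ 0] allI impI) (simp add: abs_mult mult_left_le_one_le)
  show "summable (\<lambda>n. (1 / 2 :: real) ^ Suc n)"
    using half_power_sums by (rule sums_summable)
qed

lemma val_nonneg: "0 \<le> val x"
  unfolding val_def by (intro suminf_nonneg val_summable) (simp add: digit_bounds)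

lemma val_le_one: "val x \<le> 1"
proof -
  have "val x \<le> (\<Sum>n. (1 / 2) ^ Suc n)"
    unfolding val_def
    by (intro suminf_le val_summable sums_summable[OF half_power_sums])
      (simp add: digit_bounds)
  then show ?thesis using half_power_sums sums_unique by fastforce
qed

text \<open>Splits off the first digit. Beyond this point the series enters only through this
  recursion and the bounds 0 and 1.\<close>

lemma val_rec: "val x = (digit x + val (dbl x)) / 2"
proof -
  have "val x = (\<Sum>n. digit ((dbl ^^ Suc n) x) * (1 / 2) ^ Suc (Suc n)) + digit x / 2"
    unfolding val_def using suminf_split_head[OF val_summable[of x]] by simp
  also have "(\<Sum>n. digit ((dbl ^^ Suc n) x) * (1 / 2) ^ Suc (Suc n))
      = (\<Sum>n. digit ((dbl ^^ n) (dbl x)) * (1 / 2) ^ Suc n * (1 / 2))"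
    by (simp add: funpow_swap1 mult_ac)
  also have "\<dots> = val (dbl x) * (1 / 2)"
    unfolding val_def by (rule suminf_mult2[symmetric, OF val_summable])
  finally show ?thesis by simp
qed

lemma val_low: "low x \<Longrightarrow> val x = val (x \<oplus> x) / 2"
  and val_high: "\<not> low x \<Longrightarrow> val x = (1 + val (\<sim> (\<sim> x \<oplus> \<sim> x))) / 2"
  using val_rec[of x] by (simp_all add: dbl_def digit_def)

section \<open>Order, negation and addition under \<open>val\<close>\<close>

lemma val_mono: "x \<sqsubseteq> y \<Longrightarrow> val x \<le> val y"
proof -
  assume "x \<sqsubseteq> y"
  define e where "e = (\<lambda>(x, y). val x - val y)"
  have "e (x, y) \<le> 0"
  proof (rule le_0_if_le_half[of "{(x, y). x \<sqsubseteq> y}" e 1])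
    fix i assume "i \<in> {(x, y). x \<sqsubseteq> y}"
    then obtain x y where i: "i = (x, y)" "x \<sqsubseteq> y" by blast
    show "e i \<le> 1" using val_le_one[of x] val_nonneg[of y] by (simp add: e_def i)
    consider "low x" "low y" | "low x" "\<not> low y" | "\<not> low x" "\<not> low y"
      using low_mono i(2) by blast
    then show "\<exists>j\<in>{(x, y). x \<sqsubseteq> y}. e i \<le> e j / 2"
    proof cases
      case 1
      then show ?thesis using i
        by (intro bexI[of _ "(x \<oplus> x, y \<oplus> y)"]) (auto simp: e_def val_low le_plus)
    next
      case 2
      \<comment> \<open>Here 1/2 separates the two values; the pair \<open>(x, x)\<close>, of error
        0, serves as witness.\<close>
      have "e i \<le> 0"
        using val_le_one[of "x \<oplus> x"] val_nonneg[of "\<sim> (\<sim> y \<oplus> \<sim> y)"]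
        by (simp add: e_def i val_low[OF 2(1)] val_high[OF 2(2)])
      then show ?thesis by (intro bexI[of _ "(x, x)"]) (auto simp: e_def le_refl)
    next
      case 3
      then show ?thesis using i
        by (intro bexI[of _ "(\<sim> (\<sim> x \<oplus> \<sim> x), \<sim> (\<sim> y \<oplus> \<sim> y))"])
          (auto simp: e_def val_high le_plus le_neg add_divide_distrib diff_divide_distrib)
    qed
  qed (use \<open>x \<sqsubseteq> y\<close> in simp)
  then show ?thesis by (simp add: e_def)
qed

text \<open>The high branch of doubling fixes \<open>\<one>\<close>, so its value \<open>v\<close>
  satisfies \<open>v = (1 + v) / 2\<close>.\<close>

lemma val_one: "val \<one> = 1"
proof -
  have "\<not> low \<one>"
    using not_one_le_zero by (simp add: low_def mv_one_def neg_neg)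
  moreover have "\<sim> (\<sim> \<one> \<oplus> \<sim> \<one>) = (\<one> :: 'a)"
    by (simp add: mv_one_def neg_neg plus_zero)
  ultimately show ?thesis using val_high[of \<one>] by simp
qed

lemma val_neg: "val (\<sim> x) = 1 - val x"
proof -
  define e where "e x = \<bar>val x + val (\<sim> x) - 1\<bar>" for x
  have "e x \<le> 0"
  proof (rule le_0_if_le_half[of UNIV e 1])
    fix x
    show "e x \<le> 1"
      using val_le_one[of x] val_nonneg[of x] val_le_one[of "\<sim> x"] val_nonneg[of "\<sim> x"]
      by (simp add: e_def)
    consider "low x" "low (\<sim> x)" | "low x" "\<not> low (\<sim> x)" | "\<not> low x" "low (\<sim> x)"
      using low_neg by blast
    then have "\<exists>j. e x \<le> e j / 2"
    proof cases
      case 1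
      \<comment> \<open>Here \<open>x\<close> is 1/2 modulo \<open>M\<close>: its digits are 0, 1,
        1, ..., and both doubles have value 1.\<close>
      have one: "val (y \<oplus> y) = 1" if "\<sim> y \<sqsubseteq> y" for y
        using val_mono[OF le_plus[OF that le_refl[of y]]] val_le_one[of "y \<oplus> y"]
        by (simp add: neg_plus_self val_one)
      have "val (x \<oplus> x) = 1" "val (\<sim> x \<oplus> \<sim> x) = 1"
        using one[of x] one[of "\<sim> x"] 1 by (simp_all add: low_def neg_neg)
      then have "e x = 0"
        using val_low[OF 1(1)] val_low[OF 1(2)] by (simp add: e_def)
      then show ?thesis by (intro exI[of _ x]) simp
    next
      case 2
      then have "val x + val (\<sim> x) - 1 = (val (x \<oplus> x) + val (\<sim> (x \<oplus> x)) - 1) / 2"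
        using val_low[OF 2(1)] val_high[OF 2(2)] by (simp add: neg_neg)
      then have "e x = e (x \<oplus> x) / 2" by (simp only: e_def abs_divide abs_numeral)
      then show ?thesis by (intro exI[of _ "x \<oplus> x"]) simp
    next
      case 3
      then have "val x + val (\<sim> x) - 1
          = (val (\<sim> x \<oplus> \<sim> x) + val (\<sim> (\<sim> x \<oplus> \<sim> x)) - 1) / 2"
        using val_low[OF 3(2)] val_high[OF 3(1)] by (simp add: neg_neg)
      then have "e x = e (\<sim> x \<oplus> \<sim> x) / 2" by (simp only: e_def abs_divide abs_numeral)
      then show ?thesis by (intro exI[of _ "\<sim> x \<oplus> \<sim> x"]) simp
    qed
    then show "\<exists>j\<in>UNIV. e x \<le> e j / 2" by simp
  qed simp
  then show ?thesis by (simp add: e_def)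
qed

text \<open>If some entry exceeds 1/2, symmetry moves it to third place and \<open>tri_high\<close>
  doubles the error; otherwise \<open>tri_low\<close> doubles it and flips its sign, hence the
  absolute value in \<open>e\<close>.\<close>

lemma val_tri:
  assumes "tri x y z"
  shows "val x + val y + val z = 1"
proof -
  define e where "e = (\<lambda>(x, y, z). \<bar>val x + val y + val z - 1\<bar>)"
  define S where "S = {(x, y, z). tri x y z}"
  have high: "\<exists>j\<in>S. e (x, y, z) \<le> e j / 2" if "tri x y z" "\<not> low z" for x y z
  proof
    note t = tri_high[OF that]
    show "(x \<oplus> x, y \<oplus> y, \<sim> (\<sim> z \<oplus> \<sim> z)) \<in> S" using t(3) by (simp add: S_def)
    have "val x + val y + val z - 1
        = (val (x \<oplus> x) + val (y \<oplus> y) + val (\<sim> (\<sim> z \<oplus> \<sim> z)) - 1) / 2"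
      using val_low[OF t(1)] val_low[OF t(2)] val_high[OF that(2)] by simp
    then show "e (x, y, z) \<le> e (x \<oplus> x, y \<oplus> y, \<sim> (\<sim> z \<oplus> \<sim> z)) / 2"
      by (simp only: e_def prod.case abs_divide abs_numeral order_refl)
  qed
  have "e (x, y, z) \<le> 0"
  proof (rule le_0_if_le_half[of S e 2])
    fix i assume "i \<in> S"
    then obtain x y z where i: "i = (x, y, z)" "tri x y z" by (auto simp: S_def)
    show "e i \<le> 2"
      using val_le_one[of x] val_le_one[of y] val_le_one[of z]
        val_nonneg[of x] val_nonneg[of y] val_nonneg[of z]
      by (simp add: e_def i)
    have "e (x, z, y) = e i" "e (y, z, x) = e i"
      by (simp_all add: e_def i add_ac)
    moreover have "tri x z y" "tri y z x"
      using i(2) tri_swap12 tri_swap23 by blast+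
    ultimately have 1: "\<exists>j\<in>S. e i \<le> e j / 2" if "\<not> (low x \<and> low y \<and> low z)"
      using that high[of x y z] high[of x z y] high[of y z x] i by auto
    have 2: "\<exists>j\<in>S. e i \<le> e j / 2" if "low x" "low y" "low z"
    proof
      show "(\<sim> (x \<oplus> x), \<sim> (y \<oplus> y), \<sim> (z \<oplus> z)) \<in> S"
        using tri_low[OF i(2) that] by (simp add: S_def)
      have "val x + val y + val z - 1 =
          - ((val (\<sim> (x \<oplus> x)) + val (\<sim> (y \<oplus> y)) + val (\<sim> (z \<oplus> z)) - 1) / 2)"
        using val_low[OF that(1)] val_low[OF that(2)] val_low[OF that(3)]
        by (simp add: val_neg field_simps)
      then show "e i \<le> e (\<sim> (x \<oplus> x), \<sim> (y \<oplus> y), \<sim> (z \<oplus> z)) / 2"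
        by (simp only: e_def i prod.case abs_minus_cancel abs_divide abs_numeral order_refl)
    qed
    show "\<exists>j\<in>S. e i \<le> e j / 2" using 1 2 by blast
  qed (use assms in \<open>simp add: S_def\<close>)
  then show ?thesis by (simp add: e_def)
qed

lemma val_plus: "val (x \<oplus> y) = min 1 (val x + val y)"
proof (cases "x \<sqsubseteq> \<sim> y")
  case True
  then have "tri x y (\<sim> (x \<oplus> y))" by (simp add: tri_def eqv_refl)
  then have "val (x \<oplus> y) = val x + val y"
    using val_tri val_neg by fastforce
  then show ?thesis using val_le_one[of "x \<oplus> y"] by simp
next
  case False
  then have yx: "\<sim> y \<sqsubseteq> x" using le_total by blast
  have "\<one> \<sqsubseteq> x \<oplus> y"
    using le_plus[OF yx le_refl[of y]] by (simp add: neg_plus_self)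
  then have "val (x \<oplus> y) = 1"
    using val_mono[of \<one> "x \<oplus> y"] val_one val_le_one[of "x \<oplus> y"] by simp
  moreover have "1 \<le> val x + val y"
    using val_mono[OF yx] val_neg by simp
  ultimately show ?thesis by simp
qed

lemma val_zero: "val 0 = 0"
  using val_neg[of 0] val_one by (simp add: mv_one_def)

lemma mv_character_val: "mv_character val"
  by (simp add: mv_character_def val_zero val_plus val_neg)

lemma val_eq_0_iff: "val x = 0 \<longleftrightarrow> x \<in> M"
proof
  assume "x \<in> M"
  then show "val x = 0"
    using val_mono[of x 0] val_zero val_nonneg[of x] by (simp add: le_zero_iff)
next
  assume x: "val x = 0"
  \<comment> \<open>All multiples of an element of value 0 have value 0, so none reaches
    \<open>\<one>\<close>.\<close>
  have "val (((\<oplus>) x ^^ n) 0) = 0" for n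
    by (induction n) (simp_all add: val_zero val_plus x)
  then have "\<not> \<one> \<sqsubseteq> ((\<oplus>) x ^^ n) 0" for n
    using val_mono[of \<one> "((\<oplus>) x ^^ n) 0"] val_one by auto
  then show "x \<in> M"
    using archimedean by blast
qed

end

theorem mv_character_of_maximal_ideal:
  fixes M :: "'a::mv_algebra set"
  assumes "mv_maximal_ideal M"
  obtains h where "mv_character h" "\<And>x. h x = 0 \<longleftrightarrow> x \<in> M"
proof -
  interpret mv_maximal M using assms by unfold_locales
  show thesis using that mv_character_val val_eq_0_iff by blast
qed


section \<open>Characters and products\<close>

context
  fixes h :: "'a::mv_algebra \<Rightarrow> real"
  assumes h: "mv_character h"
begin

lemma mv_character_zero: "h 0 = 0"
  and mv_character_plus: "h (x \<oplus> y) = min 1 (h x + h y)"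
  and mv_character_neg: "h (\<sim> x) = 1 - h x"
  using h by (auto simp: mv_character_def)

lemma mv_character_one: "h \<one> = 1"
  by (simp add: mv_one_def mv_character_zero mv_character_neg)

lemma mv_character_le_one: "h x \<le> 1"
  using mv_character_plus[of x 0] by (simp add: plus_zero mv_character_zero)

lemma mv_character_nonneg: "0 \<le> h x"
  using mv_character_le_one[of "\<sim> x"] by (simp add: mv_character_neg)

lemma mv_character_diff: "h (mv_diff x y) = max 0 (h x - h y)"
  by (simp add: mv_diff_def mv_character_neg mv_character_plus)

lemma mv_character_inf: "h (mv_inf x y) = min (h x) (h y)"
  using mv_character_nonneg[of x] mv_character_nonneg[of y]
  by (simp add: mv_inf_diff mv_character_diff)

lemma mv_character_summable: "mv_summable x y \<Longrightarrow> h x + h y \<le> 1"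
  using mv_character_plus[of "\<sim> x" "\<sim> y"]
  by (simp add: mv_summable_def mv_le_def mv_character_one mv_character_neg)

lemma mv_character_sum: "mv_summable x y \<Longrightarrow> h (x \<oplus> y) = h x + h y"
  using mv_character_summable by (simp add: mv_character_plus)

end

section \<open>Uniqueness of dominated additive maps\<close>

lemma mv_summable_neg: "mv_summable x (\<sim> x)"
  by (simp add: mv_summable_def neg_neg mv_le_refl)

lemma mv_plus_neg_self: "x \<oplus> \<sim> x = \<one>"
  using neg_plus_self plus_comm by metis

text \<open>The error is invariant under negation, so \<open>\<phi> x \<le> 1 / 2\<close> may be
  assumed. Then \<open>x\<close> can be replaced by its meet with \<open>\<sim> x\<close> without
  changing either map, and the double of that meet is a partial sum with twice the error.\<close>

lemma proportional_if_dominated: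
  fixes g \<phi> :: "'a::mv_algebra \<Rightarrow> real"
  assumes g_add: "\<And>x y. mv_summable x y \<Longrightarrow> g (x \<oplus> y) = g x + g y"
    and \<phi>_add: "\<And>x y. mv_summable x y \<Longrightarrow> \<phi> (x \<oplus> y) = \<phi> x + \<phi> y"
    and \<phi>_inf: "\<And>x y. \<phi> (mv_inf x y) = min (\<phi> x) (\<phi> y)"
    and \<phi>_one: "\<phi> \<one> = 1"
    and g_nonneg: "\<And>x. 0 \<le> g x"
    and g_le: "\<And>x. g x \<le> \<phi> x"
  shows "g x = \<phi> x * g \<one>"
proof -
  define e where "e x = \<bar>g x - \<phi> x * g \<one>\<bar>" for x
  have g_neg: "g (\<sim> x) = g \<one> - g x" for x
    using g_add[OF mv_summable_neg[of x]] by (simp add: mv_plus_neg_self)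
  have \<phi>_neg: "\<phi> (\<sim> x) = 1 - \<phi> x" for x
    using \<phi>_add[OF mv_summable_neg[of x]] by (simp add: mv_plus_neg_self \<phi>_one)
  have e_neg: "e (\<sim> x) = e x" for x
    by (simp add: e_def g_neg \<phi>_neg algebra_simps)
  have \<phi>_nonneg: "0 \<le> \<phi> x" for x
    using g_nonneg g_le order_trans by blast
  have \<phi>_le: "\<phi> x \<le> 1" for x
    using \<phi>_nonneg[of "\<sim> x"] by (simp add: \<phi>_neg)
  have half: "\<exists>y. e x \<le> e y / 2" if "\<phi> x \<le> 1 / 2" for x
  proof -
    \<comment> \<open>\<open>w\<close> is the overflow \<open>2x - 1\<close> of doubling, and
      \<open>m\<close> is the meet of \<open>x\<close> and \<open>\<sim> x\<close>.\<close>
    define w where "w = mv_diff x (\<sim> x)"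
    define m where "m = mv_diff x w"
    have "w \<preceq> x" by (simp add: w_def mv_diff_le)
    then have x: "m \<oplus> w = x"
      by (metis m_def mv_diff_def mv_le_def mv_one_def mv_sup_diff neg_neg plus_comm plus_zero)
    have "mv_summable m w"
      unfolding mv_summable_def m_def mv_diff_le_iff mv_plus_neg_self
      by (simp add: mv_le_def one_plus)
    then have sum: "g x = g m + g w" "\<phi> x = \<phi> m + \<phi> w"
      using g_add \<phi>_add x by metis+
    have "\<phi> m = \<phi> x"
      using \<phi>_inf[of x "\<sim> x"] that by (simp add: mv_inf_diff m_def w_def \<phi>_neg)
    \<comment> \<open>Additivity gives \<open>\<phi> w = 0\<close>, and domination then forces
      \<open>g w = 0\<close>.\<close>
    then have "g m = g x"
      using sum g_le[of w] g_nonneg[of w] by simp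
    have "m \<preceq> x" "m \<preceq> \<sim> x"
      by (simp_all add: m_def w_def mv_diff_le mv_diff_diff_le)
    then have "mv_summable m m"
      unfolding mv_summable_def by (metis mv_le_def mv_le_trans neg_neg plus_comm)
    then have "g x - \<phi> x * g \<one> = (g (m \<oplus> m) - \<phi> (m \<oplus> m) * g \<one>) / 2"
      using g_add \<phi>_add \<open>\<phi> m = \<phi> x\<close> \<open>g m = g x\<close> by (simp add: algebra_simps)
    then have "e x = e (m \<oplus> m) / 2" by (simp only: e_def abs_divide abs_numeral)
    then show ?thesis by auto
  qed
  have "e x \<le> 0"
  proof (rule le_0_if_le_half[of UNIV e 1])
    fix x
    show "\<exists>y\<in>UNIV. e x \<le> e y / 2"
      using half[of x] half[of "\<sim> x"] by (cases "\<phi> x \<le> 1 / 2") (auto simp: \<phi>_neg e_neg)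
    have "0 \<le> \<phi> x * g \<one>" "\<phi> x * g \<one> \<le> 1"
      using \<phi>_nonneg \<phi>_le g_nonneg g_le[of \<one>] \<phi>_one by (simp_all add: mult_le_one)
    then show "e x \<le> 1"
      using g_nonneg[of x] g_le[of x] \<phi>_le[of x] by (simp add: e_def)
  qed simp
  then show ?thesis by (simp add: e_def)
qed

section \<open>Characters of the tensor product\<close>

lemma mv_character_tensor:
  fixes k :: "('a::mv_algebra, 'b::mv_algebra) mv_tensor \<Rightarrow> real"
  assumes k: "mv_character k"
  shows mv_character_tensor_sum_left:
      "\<And>x x' y. mv_summable x x' \<Longrightarrow> k ((x \<oplus> x') \<otimes> y) = k (x \<otimes> y) + k (x' \<otimes> y)"
    and mv_character_tensor_sum_right:
      "\<And>x y y'. mv_summable y y' \<Longrightarrow> k (x \<otimes> (y \<oplus> y')) = k (x \<otimes> y) + k (x \<otimes> y')"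
    and mv_character_tensor_inf_left:
      "\<And>x x' y. k (mv_inf x x' \<otimes> y) = min (k (x \<otimes> y)) (k (x' \<otimes> y))"
proof -
  have bi: "mv_bilinear ((\<otimes>) :: 'a \<Rightarrow> 'b \<Rightarrow> ('a, 'b) mv_tensor)"
    and lat: "mv_lattice_hom (\<lambda>x :: 'a. x \<otimes> y)" for y :: 'b
    using mv_bimorphism_gen[where 'a = 'a and 'b = 'b] by (simp_all add: mv_bimorphism_def)
  show "k ((x \<oplus> x') \<otimes> y) = k (x \<otimes> y) + k (x' \<otimes> y)" if "mv_summable x x'" for x x' y
    using bi that mv_character_sum[OF k] by (simp add: mv_bilinear_def mv_linear_def)
  show "k (x \<otimes> (y \<oplus> y')) = k (x \<otimes> y) + k (x \<otimes> y')" if "mv_summable y y'" for x y y'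
    using bi that mv_character_sum[OF k] by (simp add: mv_bilinear_def mv_linear_def)
  show "k (mv_inf x x' \<otimes> y) = min (k (x \<otimes> y)) (k (x' \<otimes> y))" for x x' y
    using lat[of y] mv_character_inf[OF k] by (simp add: mv_lattice_hom_def)
qed

text \<open>For fixed \<open>y\<close>, \<open>x \<mapsto> k (x \<otimes> y)\<close> is dominated by
  \<open>x \<mapsto> k (x \<otimes> \<one>)\<close>, because \<open>y + \<sim> y = \<one>\<close>.
  The constant of proportionality is its value at \<open>\<one>\<close>.\<close>

lemma mv_character_tensor_prod:
  fixes k :: "('a::mv_algebra, 'b::mv_algebra) mv_tensor \<Rightarrow> real"
  assumes k: "mv_character k"
  shows "k (x \<otimes> y) = k (x \<otimes> \<one>) * k (\<one> \<otimes> y)"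
proof (rule proportional_if_dominated)
  fix x
  have "k (x \<otimes> \<one>) = k (x \<otimes> y) + k (x \<otimes> \<sim> y)"
    using mv_character_tensor_sum_right[OF k mv_summable_neg[of y]]
    by (simp add: mv_plus_neg_self)
  then show "k (x \<otimes> y) \<le> k (x \<otimes> \<one>)"
    using mv_character_nonneg[OF k, of "x \<otimes> \<sim> y"] by simp
qed (simp_all add: k mv_character_tensor mv_character_nonneg mv_tensor_gen_one mv_character_one)

text \<open>The same argument for \<open>x \<mapsto> k ((a * x) \<otimes> \<one>)\<close>, which is
  additive by bilinearity of the product and dominated since
  \<open>a * x + \<sim> a * x = x\<close>. The factor in \<open>y\<close> is then restored by
  \<open>mv_character_tensor_prod\<close>.\<close>

lemma mv_character_tensor_mult:
  fixes k :: "('a::unital_pmv_algebra, 'b::mv_algebra) mv_tensor \<Rightarrow> real"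
  assumes k: "mv_character k"
  shows "k ((a * x) \<otimes> y) = k (a \<otimes> \<one>) * k (x \<otimes> y)"
proof -
  have "k ((a * x) \<otimes> \<one>) = k (x \<otimes> \<one>) * k ((a * \<one>) \<otimes> \<one>)"
  proof (rule proportional_if_dominated)
    fix x
    have "k (x \<otimes> \<one>) = k ((a * x) \<otimes> \<one>) + k ((\<sim> a * x) \<otimes> \<one>)"
      using mult_linear_left[OF mv_summable_neg[of a], of x]
        mv_character_tensor_sum_left[OF k, of "a * x" "\<sim> a * x" \<one>]
      by (simp add: mv_plus_neg_self mult_one_left)
    then show "k ((a * x) \<otimes> \<one>) \<le> k (x \<otimes> \<one>)"
      using mv_character_nonneg[OF k, of "(\<sim> a * x) \<otimes> \<one>"] by simp
  qed (simp_all add: k mv_character_tensor mv_character_nonneg mv_tensor_gen_one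
      mv_character_one mult_linear_right)
  then show ?thesis
    using mv_character_tensor_prod[OF k, of "a * x" y] mv_character_tensor_prod[OF k, of x y]
    by (simp add: mult_one_right)
qed


section \<open>The action on the semisimple tensor product\<close>

lemma mv_character_abs_mod_rad:
  fixes h :: "'a::mv_algebra mv_mod_rad \<Rightarrow> real"
  assumes "mv_character h"
  shows "mv_character (\<lambda>t. h (abs_mv_mod_rad t))"
  using assms
  by (simp add: mv_character_def zero_mv_mod_rad.abs_eq[symmetric]
      mv_plus_mv_mod_rad.abs_eq[symmetric] mv_neg_mv_mod_rad.abs_eq[symmetric])

text \<open>Each maximal ideal \<open>M\<close> is the kernel of a character that descends to the
  quotient; equal values put \<open>mv_dist s t\<close> into every \<open>M\<close>, hence into the
  radical.\<close>

lemma mv_mod_rad_characters_separate: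
  fixes u v :: "'a::mv_algebra mv_mod_rad"
  assumes eq: "\<And>h. mv_character h \<Longrightarrow> h u = h v"
  shows "u = v"
proof -
  obtain s t where st: "u = abs_mv_mod_rad s" "v = abs_mv_mod_rad t"
    using Quotient3_abs_rep[OF Quotient3_mv_mod_rad] by metis
  have "mv_dist s t \<in> M" if "mv_maximal_ideal M" for M :: "'a set"
  proof -
    obtain k where k: "mv_character k" and ker: "\<And>x. k x = 0 \<longleftrightarrow> x \<in> M"
      using mv_character_of_maximal_ideal[OF \<open>mv_maximal_ideal M\<close>] by metis
    have cong: "k x = k y" if "mv_rad_cong x y" for x y
    proof -
      have "mv_diff x y \<in> M" "mv_diff y x \<in> M"
        using that \<open>mv_maximal_ideal M\<close> unfolding mv_rad_cong_iff mv_Rad_def by auto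
      then show ?thesis
        unfolding ker[symmetric] mv_character_diff[OF k] by simp
    qed
    \<comment> \<open>By \<open>cong\<close> the chosen representative does not affect the
      value.\<close>
    define h where "h w = k (rep_mv_mod_rad w)" for w
    have h_abs: "h (abs_mv_mod_rad x) = k x" for x
      unfolding h_def
      by (intro cong Quotient3_rep_abs[OF Quotient3_mv_mod_rad] mv_rad_cong_refl)
    have "mv_character h"
      unfolding mv_character_def
    proof (intro conjI allI)
      show "h 0 = 0"
        by (simp add: zero_mv_mod_rad.abs_eq h_abs mv_character_zero[OF k])
      fix w z
      show "h (w \<oplus> z) = min 1 (h w + h z)"
        by (induction w rule: mv_mod_rad.abs_induct, induction z rule: mv_mod_rad.abs_induct)
          (simp add: mv_plus_mv_mod_rad.abs_eq h_abs mv_character_plus[OF k])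
      show "h (\<sim> w) = 1 - h w"
        by (induction w rule: mv_mod_rad.abs_induct)
          (simp add: mv_neg_mv_mod_rad.abs_eq h_abs mv_character_neg[OF k])
    qed
    from eq[OF this] have "k s = k t" by (simp add: st h_abs)
    then have "k (mv_dist s t) = 0"
      unfolding mv_dist_def mv_character_plus[OF k] mv_character_diff[OF k] by simp
    then show ?thesis by (simp add: ker)
  qed
  then have "mv_rad_cong s t"
    by (simp add: mv_rad_cong_def mv_Rad_def)
  then show ?thesis
    using Quotient3_rel_abs[OF Quotient3_mv_mod_rad] st by metis
qed

text \<open>Definedness is the equation \<open>\<sim> u \<oplus> \<sim> v = \<one>\<close>, so
  separation applies.\<close>

lemma mv_mod_rad_summableI:
  fixes u v :: "'a::mv_algebra mv_mod_rad"
  assumes "\<And>h. mv_character h \<Longrightarrow> h u + h v \<le> 1"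
  shows "mv_summable u v"
  unfolding mv_summable_def mv_le_def
  by (rule mv_mod_rad_characters_separate)
    (use assms in \<open>force simp: mv_character_plus mv_character_neg mv_character_one\<close>)

definition ss_gen :: "'a::mv_algebra \<Rightarrow> 'b::mv_algebra \<Rightarrow> ('a, 'b) mv_ss_tensor"
  where "ss_gen x y = abs_mv_mod_rad (x \<otimes> y)"

text \<open>Multiplication by \<open>e = a \<otimes> 1\<close> stays in the algebra: \<open>e (s \<oplus> t) = e \<and> (e s \<oplus> e t)\<close> and
  \<open>e (\<sim> s) = e - e s\<close>.\<close>

lemma ss_tensor_scale_exists:
  fixes a :: "'a::unital_pmv_algebra" and u :: "('a, 'b::mv_algebra) mv_ss_tensor"
  shows "\<exists>w :: ('a, 'b) mv_ss_tensor. \<forall>h. mv_character h \<longrightarrow> h w = h (ss_gen a \<one>) * h u"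
proof -
  define e :: "('a, 'b) mv_ss_tensor" where "e = ss_gen a \<one>"
  define q :: "('a, 'b) tensor_term \<Rightarrow> ('a, 'b) mv_ss_tensor"
    where "q t = abs_mv_mod_rad (abs_mv_tensor t)" for t
  have "\<exists>w. \<forall>h. mv_character h \<longrightarrow> h w = h e * h (q t)" for t
  proof (induction t)
    case (Gen x y)
    \<comment> \<open>The product of \<open>A\<close> supplies the witness on generators.\<close>
    have "h (ss_gen (a * x) y) = h e * h (ss_gen x y)" if "mv_character h"
      for h :: "('a, 'b) mv_ss_tensor \<Rightarrow> real"
      using mv_character_tensor_mult[OF mv_character_abs_mod_rad[OF that]]
      by (simp add: ss_gen_def e_def)
    then show ?case by (auto simp: q_def ss_gen_def mv_tensor_gen.abs_eq)
  next
    case TZero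
    have "q TZero = 0"
      by (simp add: q_def zero_mv_mod_rad.abs_eq zero_mv_tensor_def)
    then show ?case using mv_character_zero by (intro exI[of _ 0]) auto
  next
    case (TPlus s t)
    then obtain v w where v: "\<And>h. mv_character h \<Longrightarrow> h v = h e * h (q s)"
      and w: "\<And>h. mv_character h \<Longrightarrow> h w = h e * h (q t)" by blast
    have q: "q (s [+] t) = q s \<oplus> q t"
      by (simp add: q_def mv_plus_mv_tensor.abs_eq mv_plus_mv_mod_rad.abs_eq)
    have "h (mv_inf e (v \<oplus> w)) = h e * h (q (s [+] t))" if h: "mv_character h" for h
    proof -
      \<comment> \<open>The truncation of \<open>v \<oplus> w\<close> at 1 is absorbed by the meet,
        as \<open>h e \<le> 1\<close>.\<close>
      have "h (mv_inf e (v \<oplus> w)) = min (h e) (h e * (h (q s) + h (q t)))"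
        using mv_character_le_one[OF h, of e]
        by (simp add: mv_character_inf[OF h] mv_character_plus[OF h] v[OF h] w[OF h]
            distrib_left)
      also have "\<dots> = h e * min 1 (h (q s) + h (q t))"
        using mv_character_nonneg[OF h, of e] by (simp add: min_mult_distrib_left)
      finally show ?thesis by (simp add: q mv_character_plus[OF h])
    qed
    then show ?case by blast
  next
    case (TNeg t)
    then obtain w where w: "\<And>h. mv_character h \<Longrightarrow> h w = h e * h (q t)" by blast
    have q: "q ([~] t) = \<sim> (q t)"
      by (simp add: q_def mv_neg_mv_tensor.abs_eq mv_neg_mv_mod_rad.abs_eq)
    have "h (mv_diff e w) = h e * h (q ([~] t))" if h: "mv_character h" for h
    proof -
      have "0 \<le> h e * (1 - h (q t))"
        using mv_character_nonneg[OF h] mv_character_le_one[OF h] by simp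
      then show ?thesis
        by (simp add: mv_character_diff[OF h] w[OF h] q mv_character_neg[OF h] algebra_simps)
    qed
    then show ?case by blast
  qed
  moreover obtain t where "u = q t"
    unfolding q_def
    using Quotient3_abs_rep[OF Quotient3_mv_mod_rad] Quotient3_abs_rep[OF Quotient3_mv_tensor]
    by metis
  ultimately show ?thesis by (simp add: e_def)
qed

theorem theorem3p6:
  assumes "mv_semisimple TYPE('a::unital_pmv_algebra)"
    and "mv_semisimple TYPE('b::mv_algebra)"
  shows "\<exists>act :: 'a \<Rightarrow> ('a, 'b) mv_ss_tensor \<Rightarrow> ('a, 'b) mv_ss_tensor. mv_module act"
proof -
  \<comment> \<open>The scaled elements are chosen for all \<open>a\<close> and \<open>u\<close>;
    separation makes each of them unique, so module laws reduce to identities between real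
    products.\<close>
  obtain act :: "'a \<Rightarrow> ('a, 'b) mv_ss_tensor \<Rightarrow> ('a, 'b) mv_ss_tensor"
    where act: "\<And>a u h. mv_character h \<Longrightarrow> h (act a u) = h (ss_gen a \<one>) * h u"
    using ss_tensor_scale_exists by metis
  have gen: "h (ss_gen (a * b) \<one>) = h (ss_gen a \<one>) * h (ss_gen b \<one>)"
    "h (ss_gen \<one> \<one>) = 1"
    "mv_summable a b \<Longrightarrow> h (ss_gen (a \<oplus> b) \<one>) = h (ss_gen a \<one>) + h (ss_gen b \<one>)"
    if "mv_character h" for h :: "('a, 'b) mv_ss_tensor \<Rightarrow> real" and a b
  proof -
    note k = mv_character_abs_mod_rad[OF that]
    show "h (ss_gen (a * b) \<one>) = h (ss_gen a \<one>) * h (ss_gen b \<one>)"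
      using mv_character_tensor_mult[OF k] by (simp add: ss_gen_def)
    show "h (ss_gen \<one> \<one>) = 1"
      using mv_character_one[OF k] by (simp add: ss_gen_def mv_tensor_gen_one)
    show "mv_summable a b \<Longrightarrow> h (ss_gen (a \<oplus> b) \<one>) = h (ss_gen a \<one>) + h (ss_gen b \<one>)"
      using mv_character_tensor_sum_left[OF k] by (simp add: ss_gen_def)
  qed
  \<comment> \<open>A sum of values equal to \<open>h z\<close> is at most 1 under every character,
    so one identity yields both definedness and value of the partial sum.\<close>
  have linear: "mv_summable w w' \<and> z = w \<oplus> w'"
    if sum: "\<And>h. mv_character h \<Longrightarrow> h z = h w + h w'" for z w w' :: "('a, 'b) mv_ss_tensor"
  proof
    have le: "h w + h w' \<le> 1" if "mv_character h" for h
      using sum[OF that] mv_character_le_one[OF that, of z] by simp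
    then show "mv_summable w w'" by (rule mv_mod_rad_summableI)
    show "z = w \<oplus> w'"
      by (rule mv_mod_rad_characters_separate) (use sum le in \<open>simp add: mv_character_plus\<close>)
  qed
  have "mv_linear (act a)" for a
    unfolding mv_linear_def
    by (intro allI impI linear) (simp add: act mv_character_sum distrib_left)
  moreover have "mv_linear (\<lambda>a. act a u)" for u
    unfolding mv_linear_def
    by (intro allI impI linear) (simp add: act gen distrib_right)
  ultimately have "mv_bilinear act"
    by (simp add: mv_bilinear_def)
  moreover have "act (a * b) u = act a (act b u)" for a b u
    by (rule mv_mod_rad_characters_separate) (simp add: act gen)
  moreover have "act \<one> u = u" for u
    by (rule mv_mod_rad_characters_separate) (simp add: act gen)
  ultimately show ?thesis
    unfolding mv_module_def by blast
qed

end
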